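(* For all integers $n,m\ge 0$ there is a diffeomorphism (of diffeological spaces, both carrying the subset diffeology from $\mathbb{R}^{n+m}$) $\Psi_{n,m}:\mathbb{R}^n\times D^m\to\mathbb{D}^{n,m}$.
   Context: Let $\ell(t)=0$ for $t\le0$, $\ell(t)=e^{-1/t}$ for $t>0$; $\alpha_0=\int_0^1\ell(3x)\ell(3-3x)\,dx$; $\lambda(t)=\frac1{\alpha_0}\int_0^t\ell(3x)\ell(3-3x)\,dx$; $\phi(t)=\int_0^{1/2+t}\lambda(x)\,dx$. $\|\cdot\|$ is the Euclidean norm; $\mathbb{R}^0$ is a point. $\mathbb{D}^{n,m}=\{(u,v)\in\mathbb{R}^n\times\mathbb{R}^m:\ \|u\|\ge1-\phi(2-\|u\|-\|v\|)\}$; $D^m=\{v\in\mathbb{R}^m:\|v\|\le1\}$. A subset of $\mathbb{R}^N$ carries the subset diffeology: plots are maps from open subsets of Euclidean spaces that are smooth as maps into $\mathbb{R}^N$. *)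

theory Defs
  imports "HOL-Analysis.Analysis"
begin

definition ell :: "real \<Rightarrow> real" where
  "ell t = (if t \<le> 0 then 0 else exp (- 1 / t))"

definition alpha0 :: real where
  "alpha0 = integral {0..1} (\<lambda>x. ell (3 * x) * ell (3 - 3 * x))"

text \<open>For t < 0 the oriented integral from 0 to t of this integrand is 0 anyway,
  since the integrand vanishes for x \<le> 0; so integral over {0..t} (empty) is correct.\<close>
definition lam :: "real \<Rightarrow> real" where
  "lam t = (1 / alpha0) * integral {0..t} (\<lambda>x. ell (3 * x) * ell (3 - 3 * x))"

definition phi :: "real \<Rightarrow> real" where
  "phi t = integral {0..1/2 + t} lam"

definition euclid :: "nat \<Rightarrow> (nat \<Rightarrow> real) set" where
  "euclid k = {x. \<forall>i. k \<le> i \<longrightarrow> x i = 0}"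

definition edist :: "nat \<Rightarrow> (nat \<Rightarrow> real) \<Rightarrow> (nat \<Rightarrow> real) \<Rightarrow> real" where
  "edist k x y = sqrt (\<Sum>i<k. (x i - y i)^2)"

definition open_euclid :: "nat \<Rightarrow> (nat \<Rightarrow> real) set \<Rightarrow> bool" where
  "open_euclid k U \<longleftrightarrow> U \<subseteq> euclid k \<and>
     (\<forall>x\<in>U. \<exists>e>0. \<forall>y\<in>euclid k. edist k y x < e \<longrightarrow> y \<in> U)"

definition cont_euclid :: "nat \<Rightarrow> (nat \<Rightarrow> real) set \<Rightarrow> ((nat \<Rightarrow> real) \<Rightarrow> real) \<Rightarrow> bool" where
  "cont_euclid k U g \<longleftrightarrow>
     (\<forall>x\<in>U. \<forall>e>0. \<exists>d>0. \<forall>y\<in>U. edist k y x < d \<longrightarrow> \<bar>g y - g x\<bar> < e)"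

fun Ck :: "nat \<Rightarrow> nat \<Rightarrow> (nat \<Rightarrow> real) set \<Rightarrow> ((nat \<Rightarrow> real) \<Rightarrow> real) \<Rightarrow> bool" where
  "Ck k 0 U g = cont_euclid k U g"
| "Ck k (Suc r) U g =
     (cont_euclid k U g \<and>
      (\<forall>i<k. (\<forall>x\<in>U. (\<lambda>t. g (x(i := x i + t))) differentiable (at 0)) \<and>
             Ck k r U (\<lambda>x. deriv (\<lambda>t. g (x(i := x i + t))) 0)))"

definition smooth_real :: "nat \<Rightarrow> (nat \<Rightarrow> real) set \<Rightarrow> ((nat \<Rightarrow> real) \<Rightarrow> real) \<Rightarrow> bool" where
  "smooth_real k U g \<longleftrightarrow> (\<forall>r. Ck k r U g)"

definition smooth_map :: "nat \<Rightarrow> (nat \<Rightarrow> real) set \<Rightarrow> nat \<Rightarrow> ((nat \<Rightarrow> real) \<Rightarrow> (nat \<Rightarrow> real)) \<Rightarrow> bool" where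
  "smooth_map k U N f \<longleftrightarrow> (\<forall>j<N. smooth_real k U (\<lambda>x. f x j))"

definition plot :: "nat \<Rightarrow> (nat \<Rightarrow> real) set \<Rightarrow> nat \<Rightarrow> (nat \<Rightarrow> real) set
                     \<Rightarrow> ((nat \<Rightarrow> real) \<Rightarrow> (nat \<Rightarrow> real)) \<Rightarrow> bool" where
  "plot N X k U p \<longleftrightarrow> open_euclid k U \<and> p ` U \<subseteq> X \<and> smooth_map k U N p"

definition dsmooth :: "nat \<Rightarrow> (nat \<Rightarrow> real) set \<Rightarrow> nat \<Rightarrow> (nat \<Rightarrow> real) set
                        \<Rightarrow> ((nat \<Rightarrow> real) \<Rightarrow> (nat \<Rightarrow> real)) \<Rightarrow> bool" where
  "dsmooth N X M Y f \<longleftrightarrow> f ` X \<subseteq> Y \<and>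
     (\<forall>k U p. plot N X k U p \<longrightarrow> plot M Y k U (f \<circ> p))"

definition diffeomorphism :: "nat \<Rightarrow> (nat \<Rightarrow> real) set \<Rightarrow> nat \<Rightarrow> (nat \<Rightarrow> real) set
                        \<Rightarrow> ((nat \<Rightarrow> real) \<Rightarrow> (nat \<Rightarrow> real)) \<Rightarrow> bool" where
  "diffeomorphism N X M Y f \<longleftrightarrow>
     bij_betw f X Y \<and> dsmooth N X M Y f \<and> dsmooth M Y N X (inv_into X f)"

section \<open>The spaces, inside R^(n+m) = R^n \<times> R^m (u = first n coordinates, v = last m)\<close>

definition normU :: "nat \<Rightarrow> (nat \<Rightarrow> real) \<Rightarrow> real" where
  "normU n z = sqrt (\<Sum>i<n. (z i)^2)"

definition normV :: "nat \<Rightarrow> nat \<Rightarrow> (nat \<Rightarrow> real) \<Rightarrow> real" where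
  "normV n m z = sqrt (\<Sum>i\<in>{n..<n+m}. (z i)^2)"

definition RnDm :: "nat \<Rightarrow> nat \<Rightarrow> (nat \<Rightarrow> real) set" where
  "RnDm n m = {z \<in> euclid (n + m). normV n m z \<le> 1}"

definition DD :: "nat \<Rightarrow> nat \<Rightarrow> (nat \<Rightarrow> real) set" where
  "DD n m = {z \<in> euclid (n + m). normU n z \<ge> 1 - phi (2 - normU n z - normV n m z)}"

end

theory Submission
  imports Defs
begin

text \<open>Write a and b for the norms of u and v, and s = a + b. On each segment with s fixed, the source
  is given by b \<le> 1 and the target by b \<le> 1 + C(s), where
  C(s) = \<open>\<phi>\<close>(2 - s) - (2 - s) \<ge> 0 vanishes for s \<le> 3/2. With the smooth cutoff
  \<open>\<rho>\<close>(b) = \<open>\<lambda>\<close>(2b - 1), the map b \<mapsto> b + C(s) \<open>\<rho>\<close>(b) at fixed s sends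
  [0, 1] increasingly onto [0, 1 + C(s)]; rescaling u and v accordingly gives \<open>\<Psi>\<close>. It is the
  identity where s < 3/2 or b < 1/2, which covers the points where a norm fails to be smooth.
  The inverse solves b + C(s) \<open>\<rho>\<close>(b) = b' for b; since C and \<open>\<rho>'\<close> are nonnegative, an
  implicit function argument along coordinate lines shows that b is as smooth as s and b'.\<close>

section \<open>Calculus of the classes Ck\<close>

text \<open>Recasts the epsilon-delta condition of \<open>cont_euclid\<close> as convergence along a
  filter, so that the limit rules for sums, products and composites apply. Pulling
  \<open>nhds 0\<close> back along \<open>edist\<close> makes only the first \<open>k\<close>
  coordinates count.\<close>

definition nhds_in :: "nat \<Rightarrow> (nat \<Rightarrow> real) set \<Rightarrow> (nat \<Rightarrow> real) \<Rightarrow> (nat \<Rightarrow> real) filter" where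
  "nhds_in k U x = inf (filtercomap (\<lambda>y. edist k y x) (nhds 0)) (principal U)"

lemma edist_nonneg: "0 \<le> edist k y x"
  by (simp add: edist_def sum_nonneg)

lemma edist_fun_upd:
  assumes "i < k"
  shows "edist k (x(i := x i + t)) x = \<bar>t\<bar>"
proof -
  have "(\<Sum>j<k. ((x(i := x i + t)) j - x j)\<^sup>2) = (\<Sum>j<k. if j = i then t\<^sup>2 else 0)"
    by (intro sum.cong) auto
  with assms show ?thesis
    by (simp add: edist_def)
qed

lemma eventually_nhds_in:
  "eventually P (nhds_in k U x) \<longleftrightarrow> (\<exists>d>0. \<forall>y\<in>U. edist k y x < d \<longrightarrow> P y)"
proof
  assume "eventually P (nhds_in k U x)"
  then obtain Q where Q: "eventually Q (nhds (0::real))"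
    "\<And>y. Q (edist k y x) \<Longrightarrow> y \<in> U \<Longrightarrow> P y"
    unfolding nhds_in_def eventually_inf_principal eventually_filtercomap by auto
  then obtain d where "d > 0" "\<And>r. dist r 0 < d \<Longrightarrow> Q r"
    unfolding eventually_nhds_metric by auto
  then show "\<exists>d>0. \<forall>y\<in>U. edist k y x < d \<longrightarrow> P y"
    using Q(2) edist_nonneg by (intro exI[of _ d]) (auto simp: dist_real_def)
next
  assume "\<exists>d>0. \<forall>y\<in>U. edist k y x < d \<longrightarrow> P y"
  then obtain d where d: "d > 0" "\<And>y. y \<in> U \<Longrightarrow> edist k y x < d \<Longrightarrow> P y" by auto
  have "eventually (\<lambda>r. r < d) (nhds (0::real))"
    using eventually_nhds_in_open[of "{..<d}" "0::real"] d(1) by simp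
  then show "eventually P (nhds_in k U x)"
    unfolding nhds_in_def eventually_inf_principal eventually_filtercomap
    using d(2) by (intro exI[of _ "\<lambda>r. r < d"]) auto
qed

lemma cont_euclid_iff:
  "cont_euclid k U g \<longleftrightarrow> (\<forall>x\<in>U. (g \<longlongrightarrow> g x) (nhds_in k U x))"
  unfolding cont_euclid_def tendsto_iff eventually_nhds_in dist_real_def by blast

lemma eventually_fun_upd_in:
  assumes "open_euclid k U" "x \<in> U" "i < k"
  shows "eventually (\<lambda>t. x(i := x i + t) \<in> U) (nhds 0)"
proof -
  from assms obtain e where e: "e > 0" "\<And>y. y \<in> euclid k \<Longrightarrow> edist k y x < e \<Longrightarrow> y \<in> U"
    and x: "x \<in> euclid k"
    unfolding open_euclid_def by blast
  have "x(i := x i + t) \<in> U" if "dist t 0 < e" for t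
    using that x assms(3) by (intro e(2)) (auto simp: edist_fun_upd euclid_def)
  then show ?thesis
    unfolding eventually_nhds_metric using e(1) by blast
qed

text \<open>A change of one coordinate by \<open>t\<close> moves the point by \<open>edist\<close>
  exactly the absolute value of \<open>t\<close>. This carries continuity on \<open>U\<close> over
  to coordinate lines.\<close>

lemma filterlim_fun_upd:
  assumes "open_euclid k U" "x \<in> U" "i < k"
  shows "filterlim (\<lambda>t. x(i := x i + t)) (nhds_in k U x) (nhds 0)"
  unfolding filterlim_iff
proof (intro allI impI)
  fix P assume "eventually P (nhds_in k U x)"
  then obtain d where d: "d > 0" "\<And>y. y \<in> U \<Longrightarrow> edist k y x < d \<Longrightarrow> P y"
    unfolding eventually_nhds_in by auto
  have "eventually (\<lambda>t::real. dist t 0 < d) (nhds 0)"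
    using d(1) eventually_nhds_metric by blast
  with eventually_fun_upd_in[OF assms]
  show "eventually (\<lambda>t. P (x(i := x i + t))) (nhds 0)"
    by eventually_elim (use d assms(3) in \<open>auto simp: edist_fun_upd\<close>)
qed

text \<open>Supplies the neighbourhoods for \<open>Ck_local\<close>, cut out by strict inequalities
  on continuous functions.\<close>

lemma open_euclid_preimage:
  assumes U: "open_euclid k U" and g: "cont_euclid k U g" and S: "open S"
  shows "open_euclid k {x \<in> U. g x \<in> S}"
  unfolding open_euclid_def
proof (intro conjI ballI)
  show "{x \<in> U. g x \<in> S} \<subseteq> euclid k"
    using U by (auto simp: open_euclid_def)
  fix x assume x: "x \<in> {x \<in> U. g x \<in> S}"
  then have "eventually (\<lambda>y. g y \<in> S) (nhds_in k U x)"
    using g S unfolding cont_euclid_iff by (auto intro: topological_tendstoD)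
  then obtain d where d: "d > 0" "\<And>y. y \<in> U \<Longrightarrow> edist k y x < d \<Longrightarrow> g y \<in> S"
    unfolding eventually_nhds_in by auto
  from U x obtain e where e: "e > 0" "\<And>y. y \<in> euclid k \<Longrightarrow> edist k y x < e \<Longrightarrow> y \<in> U"
    unfolding open_euclid_def by blast
  show "\<exists>e>0. \<forall>y\<in>euclid k. edist k y x < e \<longrightarrow> y \<in> {x \<in> U. g x \<in> S}"
    using d e by (intro exI[of _ "min d e"]) auto
qed

section \<open>Restriction, locality and congruence of the classes \<open>Ck\<close>\<close>

lemma Ck_imp_cont: "Ck k r U g \<Longrightarrow> cont_euclid k U g"
  by (cases r) auto

lemma cont_euclid_subset: "cont_euclid k U g \<Longrightarrow> V \<subseteq> U \<Longrightarrow> cont_euclid k V g"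
  unfolding cont_euclid_def by (meson subsetD)

lemma Ck_subset: "Ck k r U g \<Longrightarrow> V \<subseteq> U \<Longrightarrow> Ck k r V g"
proof (induction r arbitrary: g)
  case (Suc r)
  then show ?case using cont_euclid_subset[of k U g V] by (simp add: subset_iff)
qed (simp add: cont_euclid_subset)

lemma Ck_SucD: "Ck k (Suc r) U g \<Longrightarrow> Ck k r U g"
proof (induction r arbitrary: g)
  case 0
  then show ?case by simp
next
  case (Suc r)
  note IH = Suc.IH
  have "Ck k r U (\<lambda>x. deriv (\<lambda>t. g (x(i := x i + t))) 0)" if "i < k" for i
    by (rule IH) (use Suc.prems that in \<open>subst (asm) Ck.simps(2), blast\<close>)
  with Suc.prems show ?case unfolding Ck.simps(2)[of k _ U g] by blast
qed

text \<open>The partial derivatives are those of \<open>g\<close> itself and not of a restriction,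
  so they are the same functions on every \<open>V\<close>; the induction hypothesis applies to them
  without any gluing.\<close>

lemma Ck_local:
  assumes "\<And>x. x \<in> U \<Longrightarrow> \<exists>V. open_euclid k V \<and> x \<in> V \<and> V \<subseteq> U \<and> Ck k r V g"
    and "U \<subseteq> euclid k"
  shows "Ck k r U g"
  using assms(1)
proof (induction r arbitrary: g)
  have cont: "cont_euclid k U g"
    if loc: "\<And>x. x \<in> U \<Longrightarrow> \<exists>V. open_euclid k V \<and> x \<in> V \<and> V \<subseteq> U \<and> cont_euclid k V g" for g
    unfolding cont_euclid_def
  proof (intro ballI allI impI)
    fix x and e :: real assume "x \<in> U" "e > 0"
    from loc[OF this(1)] obtain V where V: "open_euclid k V" "x \<in> V" "cont_euclid k V g"
      by blast
    then obtain d where d: "d > 0" "\<And>y. y \<in> V \<Longrightarrow> edist k y x < d \<Longrightarrow> \<bar>g y - g x\<bar> < e"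
      using \<open>e > 0\<close> unfolding cont_euclid_def by blast
    from V obtain d' where d': "d' > 0" "\<And>y. y \<in> euclid k \<Longrightarrow> edist k y x < d' \<Longrightarrow> y \<in> V"
      unfolding open_euclid_def by blast
    show "\<exists>d>0. \<forall>y\<in>U. edist k y x < d \<longrightarrow> \<bar>g y - g x\<bar> < e"
      using d d' assms(2) by (intro exI[of _ "min d d'"]) auto
  qed
  {
    case 0
    then show ?case using cont by simp
  next
    case (Suc r)
    have "cont_euclid k U g"
      using Suc.prems by (intro cont) (meson Ck_imp_cont)
    moreover have "Ck k r U (\<lambda>x. deriv (\<lambda>t. g (x(i := x i + t))) 0)" if "i < k" for i
    proof (rule Suc.IH)
      fix x assume "x \<in> U"
      from Suc.prems[OF this] obtain V
        where "open_euclid k V" "x \<in> V" "V \<subseteq> U" "Ck k (Suc r) V g" by blast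
      with that show "\<exists>V. open_euclid k V \<and> x \<in> V \<and> V \<subseteq> U \<and>
          Ck k r V (\<lambda>x. deriv (\<lambda>t. g (x(i := x i + t))) 0)"
        by (intro exI[of _ V]) simp
    qed
    moreover have "(\<lambda>t. g (x(i := x i + t))) differentiable (at 0)" if "i < k" "x \<in> U" for i x
      using Suc.prems[OF that(2)] that(1) by auto
    ultimately show ?case by simp
  }
qed

lemma has_derivative_fun_upd_cong:
  assumes "open_euclid k U" "x \<in> U" "i < k" "\<And>y. y \<in> U \<Longrightarrow> f y = g y"
  shows "((\<lambda>t. f (x(i := x i + t))) has_real_derivative D) (at 0) \<longleftrightarrow>
         ((\<lambda>t. g (x(i := x i + t))) has_real_derivative D) (at 0)"
  by (rule DERIV_cong_ev)
     (use eventually_fun_upd_in[OF assms(1-3)] assms(4) in \<open>auto elim: eventually_mono\<close>)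

lemma cont_euclid_cong:
  assumes "\<And>x. x \<in> U \<Longrightarrow> f x = g x"
  shows "cont_euclid k U f \<longleftrightarrow> cont_euclid k U g"
  unfolding cont_euclid_def using assms by (intro ball_cong refl all_cong ex_cong1) auto

text \<open>Since \<open>U\<close> is open, a derivative at a point of \<open>U\<close> only sees
  values taken inside \<open>U\<close>.\<close>

lemma Ck_cong_imp:
  assumes "open_euclid k U"
  shows "Ck k r U f \<Longrightarrow> (\<And>x. x \<in> U \<Longrightarrow> f x = g x) \<Longrightarrow> Ck k r U g"
proof (induction r arbitrary: f g)
  case 0
  then show ?case using cont_euclid_cong[of U f g k] by simp
next
  case (Suc r)
  have iff: "((\<lambda>t. f (x(i := x i + t))) has_real_derivative D) (at 0) \<longleftrightarrow>
         ((\<lambda>t. g (x(i := x i + t))) has_real_derivative D) (at 0)" if "x \<in> U" "i < k" for x i D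
    using has_derivative_fun_upd_cong[OF assms that, of f g] Suc.prems(2) by blast
  have "Ck k r U (\<lambda>x. deriv (\<lambda>t. g (x(i := x i + t))) 0)" if "i < k" for i
  proof (rule Suc.IH)
    show "Ck k r U (\<lambda>x. deriv (\<lambda>t. f (x(i := x i + t))) 0)"
      using Suc.prems(1) that by simp
  \<comment> \<open>\<open>deriv\<close> chooses a number from the derivative predicate, so
    equivalent predicates give equal values.\<close>
  qed (simp only: deriv_def iff that)
  moreover have "cont_euclid k U g"
    using cont_euclid_cong[of U f g k] Suc.prems by simp
  moreover have "(\<lambda>t. g (x(i := x i + t))) differentiable (at 0)" if "i < k" "x \<in> U" for i x
    using Suc.prems(1) that iff by (auto simp: real_differentiable_def)
  ultimately show ?case by simp
qed

text \<open>Replaces \<open>deriv\<close> by an arbitrary family of witnesses: later proofs then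
  only have to exhibit a formula for the partial derivatives.\<close>

lemma Ck_Suc_iff:
  assumes "open_euclid k U"
  shows "Ck k (Suc r) U g \<longleftrightarrow> cont_euclid k U g \<and>
    (\<exists>G. \<forall>i<k. Ck k r U (G i) \<and>
      (\<forall>x\<in>U. ((\<lambda>t. g (x(i := x i + t))) has_real_derivative G i x) (at 0)))"
    (is "_ \<longleftrightarrow> _ \<and> ?R")
proof
  assume L: "Ck k (Suc r) U g"
  then have ?R
    by (intro exI[of _ "\<lambda>i x. deriv (\<lambda>t. g (x(i := x i + t))) 0"])
       (auto simp: DERIV_deriv_iff_real_differentiable)
  with L show "cont_euclid k U g \<and> ?R" by simp
next
  assume R: "cont_euclid k U g \<and> ?R"
  then obtain G where G: "\<And>i. i < k \<Longrightarrow> Ck k r U (G i)"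
    "\<And>i x. i < k \<Longrightarrow> x \<in> U \<Longrightarrow> ((\<lambda>t. g (x(i := x i + t))) has_real_derivative G i x) (at 0)"
    by blast
  have "Ck k r U (\<lambda>x. deriv (\<lambda>t. g (x(i := x i + t))) 0)" if "i < k" for i
    by (rule Ck_cong_imp[OF assms G(1)[OF that]]) (rule DERIV_imp_deriv[OF G(2)[OF that], symmetric])
  with R G(2) show "Ck k (Suc r) U g"
    by (auto simp: real_differentiable_def)
qed

section \<open>Arithmetic of the classes \<open>Ck\<close>\<close>

lemma Ck_const: "Ck k r U (\<lambda>_. c)"
  by (induction r arbitrary: c) (auto simp: cont_euclid_iff)

lemma Ck_add:
  assumes "open_euclid k U"
  shows "Ck k r U f \<Longrightarrow> Ck k r U g \<Longrightarrow> Ck k r U (\<lambda>x. f x + g x)"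
proof (induction r arbitrary: f g)
  case 0
  then show ?case by (auto simp: cont_euclid_iff intro: tendsto_add)
next
  case (Suc r)
  from Suc.prems obtain F G where F: "\<And>i. i < k \<Longrightarrow> Ck k r U (F i)"
    "\<And>i x. i < k \<Longrightarrow> x \<in> U \<Longrightarrow> ((\<lambda>t. f (x(i := x i + t))) has_real_derivative F i x) (at 0)"
    and G: "\<And>i. i < k \<Longrightarrow> Ck k r U (G i)"
    "\<And>i x. i < k \<Longrightarrow> x \<in> U \<Longrightarrow> ((\<lambda>t. g (x(i := x i + t))) has_real_derivative G i x) (at 0)"
    unfolding Ck_Suc_iff[OF assms] by blast
  have "cont_euclid k U (\<lambda>x. f x + g x)"
    using Suc.prems by (auto simp: cont_euclid_iff intro: tendsto_add)
  with F G Suc.IH show ?case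
    unfolding Ck_Suc_iff[OF assms]
    by (intro conjI exI[of _ "\<lambda>i x. F i x + G i x"]) (auto intro: DERIV_add)
qed

lemma Ck_mult:
  assumes "open_euclid k U"
  shows "Ck k r U f \<Longrightarrow> Ck k r U g \<Longrightarrow> Ck k r U (\<lambda>x. f x * g x)"
proof (induction r arbitrary: f g)
  case 0
  then show ?case by (auto simp: cont_euclid_iff intro: tendsto_mult)
next
  case (Suc r)
  from Suc.prems obtain F G where F: "\<And>i. i < k \<Longrightarrow> Ck k r U (F i)"
    "\<And>i x. i < k \<Longrightarrow> x \<in> U \<Longrightarrow> ((\<lambda>t. f (x(i := x i + t))) has_real_derivative F i x) (at 0)"
    and G: "\<And>i. i < k \<Longrightarrow> Ck k r U (G i)"
    "\<And>i x. i < k \<Longrightarrow> x \<in> U \<Longrightarrow> ((\<lambda>t. g (x(i := x i + t))) has_real_derivative G i x) (at 0)"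
    unfolding Ck_Suc_iff[OF assms] by blast
  have "cont_euclid k U (\<lambda>x. f x * g x)"
    using Suc.prems by (auto simp: cont_euclid_iff intro: tendsto_mult)
  \<comment> \<open>The product rule involves \<open>f\<close> and \<open>g\<close> themselves, so
    these are lowered to order \<open>r\<close> by \<open>Ck_SucD\<close> before the induction
    hypothesis is applied.\<close>
  moreover have "Ck k r U (\<lambda>x. F i x * g x + G i x * f x)" if "i < k" for i
    using F(1) G(1) that Suc.prems[THEN Ck_SucD] by (intro Ck_add[OF assms] Suc.IH)
  moreover have "((\<lambda>t. f (x(i := x i + t)) * g (x(i := x i + t))) has_real_derivative
      F i x * g x + G i x * f x) (at 0)" if "i < k" "x \<in> U" for i x
    using DERIV_mult[OF F(2)[OF that] G(2)[OF that]] by simp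
  ultimately show ?case
    unfolding Ck_Suc_iff[OF assms]
    by (intro conjI exI[of _ "\<lambda>i x. F i x * g x + G i x * f x"]) auto
qed

lemma Ck_diff:
  assumes "open_euclid k U" "Ck k r U f" "Ck k r U g"
  shows "Ck k r U (\<lambda>x. f x - g x)"
  using Ck_add[OF assms(1,2) Ck_mult[OF assms(1) Ck_const[of _ _ _ "-1"] assms(3)]] by simp

lemma Ck_sum:
  assumes "open_euclid k U" "\<And>i. i \<in> I \<Longrightarrow> Ck k r U (f i)"
  shows "Ck k r U (\<lambda>x. \<Sum>i\<in>I. f i x)"
  using assms(2)
  by (induction I rule: infinite_finite_induct) (auto intro: Ck_const Ck_add[OF assms(1)])

text \<open>Smoothness of a one-variable function, encoded by its effect on composites. The set
  \<open>S\<close> allows for functions that are smooth on part of the line only, such as real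
  powers.\<close>

definition preserves_Ck :: "real set \<Rightarrow> (real \<Rightarrow> real) \<Rightarrow> bool" where
  "preserves_Ck S F \<longleftrightarrow> (\<forall>k r U g. open_euclid k U \<longrightarrow> g ` U \<subseteq> S \<longrightarrow>
     Ck k r U g \<longrightarrow> Ck k r U (\<lambda>x. F (g x)))"

lemma preserves_CkD:
  assumes "preserves_Ck S F" "open_euclid k U" "Ck k r U g" "\<And>x. x \<in> U \<Longrightarrow> g x \<in> S"
  shows "Ck k r U (\<lambda>x. F (g x))"
  using assms unfolding preserves_Ck_def by blast

lemma cont_euclid_compose:
  assumes "cont_euclid k U g" "\<And>x. x \<in> U \<Longrightarrow> isCont F (g x)"
  shows "cont_euclid k U (\<lambda>x. F (g x))"
  using assms unfolding cont_euclid_iff by (auto intro: isCont_tendsto_compose)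

text \<open>The chain rule as a gain of one order: order \<open>r\<close> for the composite with
  \<open>F'\<close> gives order \<open>Suc r\<close> for the composite with
  \<open>F\<close>.\<close>

lemma Ck_compose_step:
  assumes U: "open_euclid k U" and g: "Ck k (Suc r) U g"
    and DF: "\<And>x. x \<in> U \<Longrightarrow> (F has_real_derivative F' (g x)) (at (g x))"
    and F': "Ck k r U (\<lambda>x. F' (g x))"
  shows "Ck k (Suc r) U (\<lambda>x. F (g x))"
proof -
  from g obtain G where G: "\<And>i. i < k \<Longrightarrow> Ck k r U (G i)"
    "\<And>i x. i < k \<Longrightarrow> x \<in> U \<Longrightarrow> ((\<lambda>t. g (x(i := x i + t))) has_real_derivative G i x) (at 0)"
    unfolding Ck_Suc_iff[OF U] by blast
  have "((\<lambda>t. F (g (x(i := x i + t)))) has_real_derivative F' (g x) * G i x) (at 0)"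
    if "i < k" "x \<in> U" for i x
    using DERIV_chain2[OF _ G(2)[OF that], of F "F' (g x)"] DF[OF that(2)] by simp
  moreover have "cont_euclid k U (\<lambda>x. F (g x))"
    by (rule cont_euclid_compose[OF Ck_imp_cont[OF g] DERIV_isCont[OF DF]])
  moreover have "Ck k r U (\<lambda>x. F' (g x) * G i x)" if "i < k" for i
    by (rule Ck_mult[OF U F' G(1)[OF that]])
  ultimately show ?thesis
    unfolding Ck_Suc_iff[OF U]
    by (intro conjI exI[of _ "\<lambda>i x. F' (g x) * G i x"]) simp_all
qed

text \<open>Induction on \<open>r\<close> for all \<open>n\<close> at once: order
  \<open>Suc r\<close> of \<open>D n\<close> rests on order \<open>r\<close> of
  \<open>D (Suc n)\<close>. It serves functions whose derivatives of all orders are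
  explicit.\<close>

lemma preserves_Ck_derivative_family:
  assumes "\<And>n x. x \<in> S \<Longrightarrow> (D n has_real_derivative D (Suc n) x) (at x)"
  shows "preserves_Ck S (D n)"
proof -
  have "Ck k r U (\<lambda>x. D n (g x))"
    if "open_euclid k U" "g ` U \<subseteq> S" "Ck k r U g" for k r U g
    using that(3)
  proof (induction r arbitrary: n)
    case 0
    have "isCont (D n) (g x)" if "x \<in> U" for x
      using DERIV_isCont[OF assms] \<open>g ` U \<subseteq> S\<close> that by blast
    with 0 show ?case by (simp add: cont_euclid_compose)
  next
    case (Suc r)
    have "(D n has_real_derivative D (Suc n) (g x)) (at (g x))" if "x \<in> U" for x
      using assms \<open>g ` U \<subseteq> S\<close> that by blast
    then show ?case
      by (rule Ck_compose_step[OF that(1) Suc.prems _ Suc.IH[OF Ck_SucD[OF Suc.prems]]])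
  qed
  then show ?thesis unfolding preserves_Ck_def by blast
qed

text \<open>For functions such as \<open>lam\<close> and \<open>phi\<close>, which are given by
  integrals and inherit smoothness from the integrand.\<close>

lemma preserves_Ck_antiderivative:
  assumes DF: "\<And>x. (F has_real_derivative F' x) (at x)" and F': "preserves_Ck UNIV F'"
  shows "preserves_Ck UNIV F"
  unfolding preserves_Ck_def
proof (intro allI impI)
  fix k r U g
  assume U: "open_euclid k U" and "Ck k r U g"
  then show "Ck k r U (\<lambda>x. F (g x))"
  proof (induction r)
    case 0
    then show ?case by (simp add: cont_euclid_compose DERIV_isCont[OF DF])
  next
    case (Suc r)
    have "Ck k r U (\<lambda>x. F' (g x))"
      by (rule preserves_CkD[OF F' U Ck_SucD[OF Suc.prems(2)]]) simp
    then show ?case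
      by (rule Ck_compose_step[OF U Suc.prems(2) DF])
  qed
qed

lemma preserves_Ck_mult:
  assumes "preserves_Ck S F" "preserves_Ck S G"
  shows "preserves_Ck S (\<lambda>x. F x * G x)"
  unfolding preserves_Ck_def
proof (intro allI impI)
  fix k r U g assume U: "open_euclid k U" and S: "g ` U \<subseteq> S" and g: "Ck k r U g"
  have "Ck k r U (\<lambda>x. F (g x))" "Ck k r U (\<lambda>x. G (g x))"
    using assms U S g unfolding preserves_Ck_def by blast+
  then show "Ck k r U (\<lambda>x. F (g x) * G (g x))"
    by (rule Ck_mult[OF U])
qed

lemma preserves_Ck_const: "preserves_Ck S (\<lambda>_. c)"
  by (simp add: preserves_Ck_def Ck_const)

lemma preserves_Ck_cmult: "preserves_Ck S F \<Longrightarrow> preserves_Ck S (\<lambda>x. c * F x)"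
  by (rule preserves_Ck_mult[OF preserves_Ck_const])

lemma preserves_Ck_affine:
  assumes "preserves_Ck UNIV F"
  shows "preserves_Ck UNIV (\<lambda>x. F (c * x + d))"
  unfolding preserves_Ck_def
proof (intro allI impI)
  fix k r U g assume U: "open_euclid k U" and g: "Ck k r U g"
  show "Ck k r U (\<lambda>x. F (c * g x + d))"
    by (rule preserves_CkD[OF assms U Ck_add[OF U Ck_mult[OF U Ck_const g] Ck_const]]) simp
qed

text \<open>The derivatives are falling factorials times lower powers. The exponents -1 and 1/2
  yield division and square roots of positive functions.\<close>

lemma preserves_Ck_powr: "preserves_Ck {0<..} (\<lambda>x. x powr p)"
proof -
  define D where "D n x = (\<Prod>i<n. p - real i) * x powr (p - real n)" for n x
  have "(D n has_real_derivative D (Suc n) x) (at x)" if "x \<in> {0<..}" for n x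
    unfolding D_def using that
    by (auto intro!: derivative_eq_intros simp: algebra_simps)
  then have "preserves_Ck {0<..} (D 0)"
    by (rule preserves_Ck_derivative_family)
  moreover have "D 0 = (\<lambda>x. x powr p)"
    by (simp add: D_def fun_eq_iff)
  ultimately show ?thesis by simp
qed

lemma Ck_divide:
  assumes "open_euclid k U" "Ck k r U f" "Ck k r U g" "\<And>x. x \<in> U \<Longrightarrow> g x > 0"
  shows "Ck k r U (\<lambda>x. f x / g x)"
proof -
  have "Ck k r U (\<lambda>x. g x powr (-1))"
    by (rule preserves_CkD[OF preserves_Ck_powr assms(1,3)]) (simp add: assms(4))
  then have "Ck k r U (\<lambda>x. f x * g x powr (-1))"
    by (rule Ck_mult[OF assms(1,2)])
  then show ?thesis
    by (rule Ck_cong_imp[OF assms(1)]) (simp add: powr_minus_divide less_imp_le assms(4))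
qed

lemma Ck_sqrt:
  assumes "open_euclid k U" "Ck k r U g" "\<And>x. x \<in> U \<Longrightarrow> g x > 0"
  shows "Ck k r U (\<lambda>x. sqrt (g x))"
proof -
  have "Ck k r U (\<lambda>x. g x powr (1/2))"
    by (rule preserves_CkD[OF preserves_Ck_powr assms(1,2)]) (simp add: assms(3))
  then show ?thesis
    by (rule Ck_cong_imp[OF assms(1)]) (simp add: powr_half_sqrt less_imp_le assms(3))
qed

text \<open>Caratheodory's form \<open>\<rho> z - \<rho> (B 0) = q z * (z - B 0)\<close> turns the difference of the equation
  at t and at 0 into \<open>(B t - B 0) * (1 + C t * q (B t))\<close> on the left, so no a priori
  differentiability of B is required.\<close>

lemma implicit_has_derivative:
  fixes B C Y \<rho> :: "real \<Rightarrow> real"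
  assumes eq: "eventually (\<lambda>t. B t + C t * \<rho> (B t) = Y t) (nhds 0)"
    and C: "(C has_real_derivative C') (at 0)" "C 0 \<ge> 0"
    and Y: "(Y has_real_derivative Y') (at 0)"
    and \<rho>: "(\<rho> has_real_derivative \<rho>') (at (B 0))" "\<rho>' \<ge> 0"
    and B: "isCont B 0"
  shows "(B has_real_derivative (Y' - C' * \<rho> (B 0)) / (1 + C 0 * \<rho>')) (at 0)"
proof -
  from \<rho>(1) obtain q where q: "\<And>z. \<rho> z - \<rho> (B 0) = q z * (z - B 0)" "isCont q (B 0)" "q (B 0) = \<rho>'"
    unfolding CARAT_DERIV by blast
  let ?N = "\<lambda>t. (Y t - Y 0) / (t - 0) - (C t - C 0) / (t - 0) * \<rho> (B 0)"
  let ?M = "\<lambda>t. 1 + C t * q (B t)"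
  have N: "(?N \<longlongrightarrow> Y' - C' * \<rho> (B 0)) (at 0)"
    using C(1) Y unfolding has_field_derivative_iff by (intro tendsto_intros) auto
  have "((\<lambda>t. q (B t)) \<longlongrightarrow> q (B 0)) (at 0)"
    using isCont_tendsto_compose[OF q(2)] B unfolding isCont_def by blast
  moreover have "(C \<longlongrightarrow> C 0) (at 0)"
    using DERIV_isCont[OF C(1)] by (simp add: isCont_def)
  ultimately have M: "(?M \<longlongrightarrow> 1 + C 0 * \<rho>') (at 0)"
    unfolding q(3)[symmetric] by (intro tendsto_intros) auto
  have pos: "1 + C 0 * \<rho>' > 0"
    using C(2) \<rho>(2) by (simp add: add_pos_nonneg)
  have "((\<lambda>t. ?N t / ?M t) \<longlongrightarrow> (Y' - C' * \<rho> (B 0)) / (1 + C 0 * \<rho>')) (at 0)"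
    using pos by (intro tendsto_divide N M) auto
  moreover have "eventually (\<lambda>t. ?N t / ?M t = (B t - B 0) / (t - 0)) (at 0)"
  proof -
    \<comment> \<open>The filter \<open>nhds 0\<close>, unlike \<open>at 0\<close>, includes the
      point 0, so the equation holds there too.\<close>
    have e0: "B 0 + C 0 * \<rho> (B 0) = Y 0"
      using eq by (rule eventually_nhds_x_imp_x)
    have "eventually (\<lambda>t. B t + C t * \<rho> (B t) = Y t) (at 0)"
      using eq by (simp add: eventually_at_filter eventually_mono)
    moreover have "eventually (\<lambda>t. ?M t > 0) (at 0)"
      using order_tendstoD(1)[OF M pos] .
    moreover have "eventually (\<lambda>t::real. t \<noteq> 0) (at 0)"
      by (simp add: eventually_at_filter)
    ultimately show ?thesis
    proof eventually_elim
      case (elim t)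
      have "(B t - B 0) * ?M t = (B t - B 0) + C t * (\<rho> (B t) - \<rho> (B 0))"
        unfolding q(1) by (simp add: algebra_simps)
      also have "\<dots> = (Y t - Y 0) - (C t - C 0) * \<rho> (B 0)"
        unfolding elim(1)[symmetric] e0[symmetric] by (simp add: algebra_simps)
      also have "\<dots> = ?N t * t"
        using elim(3) by (simp add: field_simps)
      finally have "?N t = (B t - B 0) * ?M t / t"
        using elim(3) by (simp add: nonzero_eq_divide_eq)
      then show ?case
        using elim(2) by simp
    qed
  qed
  ultimately show ?thesis
    unfolding has_field_derivative_iff by (rule Lim_transform_eventually)
qed

text \<open>A bootstrap on the order. Continuity of \<open>B\<close> comes from monotonicity of
  \<rho>; after that the formula for the partial derivatives of \<open>B\<close> contains
  \<open>B\<close> only undifferentiated, at the order already known. The sign conditions keep its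
  denominator at least 1.\<close>

lemma Ck_implicit:
  assumes U: "open_euclid k U"
    and eq: "\<And>x. x \<in> U \<Longrightarrow> B x + C x * \<rho> (B x) = Y x"
    and C0: "\<And>x. x \<in> U \<Longrightarrow> C x \<ge> 0"
    and \<rho>: "\<And>b. (\<rho> has_real_derivative \<rho>' b) (at b)" "\<And>b. \<rho>' b \<ge> 0" "preserves_Ck UNIV \<rho>'"
  shows "Ck k r U C \<Longrightarrow> Ck k r U Y \<Longrightarrow> Ck k r U B"
proof -
  have mono: "\<rho> a \<le> \<rho> b" if "a \<le> b" for a b
    using DERIV_nonneg_imp_nondecreasing[OF that] \<rho>(1,2) by blast
  have cont: "cont_euclid k U B" if C: "cont_euclid k U C" and Y: "cont_euclid k U Y"
    unfolding cont_euclid_iff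
  proof
    fix x assume x: "x \<in> U"
    let ?E = "\<lambda>y. (Y y - Y x) + (C x - C y) * \<rho> (B x)"
    have "((\<lambda>y. \<bar>?E y\<bar>) \<longlongrightarrow> \<bar>(Y x - Y x) + (C x - C x) * \<rho> (B x)\<bar>) (nhds_in k U x)"
      using C Y x unfolding cont_euclid_iff by (intro tendsto_intros) auto
    then have E: "((\<lambda>y. \<bar>?E y\<bar>) \<longlongrightarrow> 0) (nhds_in k U x)" by simp
    \<comment> \<open>By monotonicity of \<open>\<rho>\<close>, both summands of \<open>?E y = (B y - B x) + C y * (\<rho> (B y) - \<rho> (B x))\<close>
      have the same sign.\<close>
    have "norm (B y - B x) \<le> \<bar>?E y\<bar>" if y: "y \<in> U" for y
    proof -
      have "?E y = (B y - B x) + C y * (\<rho> (B y) - \<rho> (B x))"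
        unfolding eq[OF x, symmetric] eq[OF y, symmetric] by (simp add: algebra_simps)
      moreover have "B y \<ge> B x \<Longrightarrow> C y * (\<rho> (B y) - \<rho> (B x)) \<ge> 0"
        using mono C0[OF y] by simp
      moreover have "B y \<le> B x \<Longrightarrow> C y * (\<rho> (B y) - \<rho> (B x)) \<le> 0"
        using mono C0[OF y] by (simp add: mult_nonneg_nonpos)
      ultimately show ?thesis by (auto simp: abs_if)
    qed
    then have "eventually (\<lambda>y. norm (B y - B x) \<le> \<bar>?E y\<bar>) (nhds_in k U x)"
      unfolding nhds_in_def eventually_inf_principal by simp
    from Lim_null_comparison[OF this E] show "(B \<longlongrightarrow> B x) (nhds_in k U x)"
      by (simp add: LIM_zero_iff)
  qed
  show "Ck k r U C \<Longrightarrow> Ck k r U Y \<Longrightarrow> Ck k r U B"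
  proof (induction r)
    case 0
    then show ?case using cont by simp
  next
    case (Suc r)
    from Suc.prems obtain F G where F: "\<And>i. i < k \<Longrightarrow> Ck k r U (F i)"
      "\<And>i x. i < k \<Longrightarrow> x \<in> U \<Longrightarrow> ((\<lambda>t. C (x(i := x i + t))) has_real_derivative F i x) (at 0)"
      and G: "\<And>i. i < k \<Longrightarrow> Ck k r U (G i)"
      "\<And>i x. i < k \<Longrightarrow> x \<in> U \<Longrightarrow> ((\<lambda>t. Y (x(i := x i + t))) has_real_derivative G i x) (at 0)"
      unfolding Ck_Suc_iff[OF U] by blast
    have B: "Ck k r U B" and contB: "cont_euclid k U B"
      using Suc Ck_SucD cont Ck_imp_cont by blast+
    have \<rho>_Ck: "preserves_Ck UNIV \<rho>"
      using \<rho>(1,3) by (rule preserves_Ck_antiderivative)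
    \<comment> \<open>The partial derivative of \<open>B\<close> delivered by
      \<open>implicit_has_derivative\<close>.\<close>
    define H where "H i x = (G i x - F i x * \<rho> (B x)) / (1 + C x * \<rho>' (B x))" for i x
    have C: "Ck k r U C"
      using Suc.prems(1) by (rule Ck_SucD)
    have \<rho>B: "Ck k r U (\<lambda>x. \<rho> (B x))" and \<rho>'B: "Ck k r U (\<lambda>x. \<rho>' (B x))"
      by (rule preserves_CkD[OF \<rho>_Ck U B] preserves_CkD[OF \<rho>(3) U B]; simp)+
    have pos: "1 + C x * \<rho>' (B x) > 0" if "x \<in> U" for x
      using C0[OF that] \<rho>(2) by (simp add: add_pos_nonneg)
    have "Ck k r U (H i)" if "i < k" for i
      unfolding H_def
      by (rule Ck_divide[OF U Ck_diff[OF U _ Ck_mult[OF U]] Ck_add[OF U Ck_const Ck_mult[OF U]] pos])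
         (rule F(1)[OF that] G(1)[OF that] C \<rho>B \<rho>'B | assumption)+
    moreover have "((\<lambda>t. B (x(i := x i + t))) has_real_derivative H i x) (at 0)"
      if i: "i < k" and x: "x \<in> U" for i x
    proof -
      have "((\<lambda>t. B (x(i := x i + t))) \<longlongrightarrow> B x) (nhds 0)"
        using contB x filterlim_compose[OF _ filterlim_fun_upd[OF U x i]]
        unfolding cont_euclid_iff by blast
      then have "isCont (\<lambda>t. B (x(i := x i + t))) 0"
        unfolding isCont_def using tendsto_mono[OF at_within_le_nhds] by fastforce
      moreover have "eventually (\<lambda>t. B (x(i := x i + t)) + C (x(i := x i + t)) * \<rho> (B (x(i := x i + t)))
          = Y (x(i := x i + t))) (nhds 0)"
        using eventually_fun_upd_in[OF U x i] by eventually_elim (use eq in auto)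
      ultimately show ?thesis
        using implicit_has_derivative[of "\<lambda>t. B (x(i := x i + t))" "\<lambda>t. C (x(i := x i + t))" \<rho>
            "\<lambda>t. Y (x(i := x i + t))" "F i x" "G i x" "\<rho>' (B x)"]
          F(2)[OF i x] G(2)[OF i x] C0[OF x] \<rho>(1,2) by (simp add: H_def)
    qed
    ultimately show ?case
      unfolding Ck_Suc_iff[OF U] using contB by blast
  qed
qed

section \<open>The functions ell, lam and phi\<close>

lemma DERIV_zero_imp_eq:
  fixes g :: "real \<Rightarrow> real"
  assumes "a \<le> b" "\<And>x. a \<le> x \<Longrightarrow> x \<le> b \<Longrightarrow> (g has_real_derivative 0) (at x)"
  shows "g a = g b"
proof (rule antisym)
  show "g a \<le> g b"
    using assms(2) by (intro DERIV_nonneg_imp_nondecreasing[OF assms(1)]) blast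
  show "g b \<le> g a"
    using assms(2) by (intro DERIV_nonpos_imp_nonincreasing[OF assms(1)]) blast
qed

text \<open>As \<open>f\<close> vanishes on the left, the lower limit 0 may be replaced by
  \<open>- K\<close> with \<open>K\<close> larger than the absolute value of \<open>x\<close>. Then
  \<open>x\<close> is interior to the interval and the fundamental theorem gives a two-sided
  derivative, also for negative \<open>x\<close>, where \<open>{0..t}\<close> is empty.\<close>

lemma integral_from_0_has_real_derivative:
  fixes f :: "real \<Rightarrow> real"
  assumes cont: "continuous_on UNIV f" and zero: "\<And>x. x \<le> 0 \<Longrightarrow> f x = 0"
  shows "((\<lambda>t. integral {0..t} f) has_real_derivative f x) (at x)"
proof -
  define K where "K = \<bar>x\<bar> + 1"
  have cont': "continuous_on S f" for S
    using cont by (rule continuous_on_subset) simp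
  have left: "integral {- K..t} f = 0" if "t \<le> 0" for t
  proof -
    have "integral {- K..t} f = integral {- K..t} (\<lambda>_. 0)"
      using zero that by (intro integral_cong) auto
    then show ?thesis by simp
  qed
  have eq: "integral {- K..t} f = integral {0..t} f" if "- K < t" for t
  proof (cases "t \<ge> 0")
    case True
    then have "integral {- K..0} f + integral {0..t} f = integral {- K..t} f"
      by (intro Henstock_Kurzweil_Integration.integral_combine)
         (auto simp: K_def intro: integrable_continuous_real cont')
    then show ?thesis using left[of 0] by simp
  next
    case False
    then show ?thesis using left[of t] by simp
  qed
  have "((\<lambda>t. integral {- K..t} f) has_real_derivative f x) (at x within {- K..K})"
    using cont' by (rule integral_has_real_derivative) (auto simp: K_def)
  then have D: "((\<lambda>t. integral {- K..t} f) has_real_derivative f x) (at x)"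
    using at_within_Icc_at[of "- K" x K] unfolding K_def by simp
  have "x \<in> {- K<..}"
    by (simp add: K_def)
  then have "eventually (\<lambda>t. t \<in> {- K<..}) (nhds x)"
    by (intro eventually_nhds_in_open) simp
  then have ev: "eventually (\<lambda>t. integral {- K..t} f = integral {0..t} f) (nhds x)"
    by (rule eventually_mono) (simp add: eq)
  show ?thesis
    by (rule DERIV_cong_ev[OF refl ev refl, THEN iffD1, OF D])
qed

section \<open>Flatness of \<open>ell\<close> at the origin\<close>

lemma poly_times_exp_tendsto_0: "((\<lambda>y. poly p y * exp (- y)) \<longlongrightarrow> (0::real)) at_top"
proof -
  have "((\<lambda>y. \<Sum>i\<le>degree p. coeff p i * (y ^ i / exp y)) \<longlongrightarrow> (\<Sum>i\<le>degree p. coeff p i * 0)) at_top"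
    by (intro tendsto_intros tendsto_power_div_exp_0)
  then show ?thesis
    by (simp add: poly_altdef sum_distrib_right exp_minus divide_inverse mult.assoc)
qed

text \<open>For t > 0 the n-th derivative of \<open>ell\<close> is P(1/t) exp(-1/t) with a
  polynomial P. With y = 1/t, differentiation replaces P by y^2 (P - P').\<close>

fun ell_poly :: "nat \<Rightarrow> real poly" where
  "ell_poly 0 = 1"
| "ell_poly (Suc n) = monom 1 2 * (ell_poly n - pderiv (ell_poly n))"

definition ell_deriv :: "nat \<Rightarrow> real \<Rightarrow> real" where
  "ell_deriv n t = (if t \<le> 0 then 0 else poly (ell_poly n) (1 / t) * exp (- 1 / t))"

text \<open>Only t = 0 needs an estimate: there the right difference quotient is a polynomial in 1/s
  times exp(-1/s), which tends to 0.\<close>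

lemma ell_deriv_has_real_derivative:
  "(ell_deriv n has_real_derivative ell_deriv (Suc n) t) (at t)"
proof -
  consider "t < 0" | "t = 0" | "t > 0" by linarith
  then show ?thesis
  proof cases
    case 1
    then have "eventually (\<lambda>s. s \<in> {..<0}) (nhds t)"
      by (intro eventually_nhds_in_open) auto
    then have ev: "eventually (\<lambda>s. ell_deriv n s = 0) (nhds t)"
      by (rule eventually_mono) (simp add: ell_deriv_def)
    have "(ell_deriv n has_real_derivative 0) (at t)"
      by (rule DERIV_cong_ev[OF refl ev refl, THEN iffD2, OF DERIV_const])
    with 1 show ?thesis by (simp add: ell_deriv_def)
  next
    case 2
    have "((\<lambda>s. ell_deriv n s / s) \<longlongrightarrow> 0) (at_left 0)"
      by (rule tendsto_eventually) (auto simp: ell_deriv_def eventually_at_filter)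
    moreover have "((\<lambda>s. ell_deriv n s / s) \<longlongrightarrow> 0) (at_right 0)"
    proof -
      \<comment> \<open>\<open>pCons 0\<close> multiplies the polynomial by its variable, which
        absorbs the factor 1/s of the difference quotient.\<close>
      have "((\<lambda>s. poly (pCons 0 (ell_poly n)) (inverse s) * exp (- inverse s)) \<longlongrightarrow> 0) (at_right 0)"
        by (rule filterlim_compose[OF poly_times_exp_tendsto_0 filterlim_inverse_at_top_right])
      then show ?thesis
        by (rule Lim_transform_eventually)
           (auto simp: ell_deriv_def eventually_at_filter divide_inverse mult_ac)
    qed
    ultimately have "((\<lambda>s. ell_deriv n s / s) \<longlongrightarrow> 0) (at 0)"
      by (rule filterlim_split_at_real)
    with 2 show ?thesis
      by (simp add: has_field_derivative_iff ell_deriv_def)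
  next
    case 3
    have D: "((\<lambda>s. poly (ell_poly n) (1 / s) * exp (- 1 / s)) has_real_derivative
        ell_deriv (Suc n) t) (at t)"
      using 3
      by (auto intro!: derivative_eq_intros
          simp: ell_deriv_def poly_monom field_simps power2_eq_square)
    have "eventually (\<lambda>s. s \<in> {0<..}) (nhds t)"
      using 3 by (intro eventually_nhds_in_open) auto
    then have ev: "eventually (\<lambda>s. poly (ell_poly n) (1 / s) * exp (- 1 / s) = ell_deriv n s) (nhds t)"
      by (rule eventually_mono) (simp add: ell_deriv_def)
    show ?thesis
      by (rule DERIV_cong_ev[OF refl ev refl, THEN iffD1, OF D])
  qed
qed

lemma preserves_Ck_ell: "preserves_Ck UNIV ell"
proof -
  have "ell = ell_deriv 0"
    by (simp add: fun_eq_iff ell_def ell_deriv_def)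
  then show ?thesis
    using preserves_Ck_derivative_family[of UNIV ell_deriv 0] ell_deriv_has_real_derivative by simp
qed

lemma isCont_ell: "isCont ell t"
proof -
  have "ell = ell_deriv 0"
    by (simp add: fun_eq_iff ell_def ell_deriv_def)
  then show ?thesis
    using DERIV_isCont[OF ell_deriv_has_real_derivative[of 0 t]] by simp
qed

section \<open>The bump function and its normalised integral \<open>lam\<close>\<close>

definition bump :: "real \<Rightarrow> real" where
  "bump x = ell (3 * x) * ell (3 - 3 * x)"

lemma preserves_Ck_bump: "preserves_Ck UNIV bump"
proof -
  have "preserves_Ck UNIV (\<lambda>x. ell (3 * x + 0) * ell (- 3 * x + 3))"
    by (intro preserves_Ck_mult preserves_Ck_affine preserves_Ck_ell)
  then show ?thesis
    by (simp add: bump_def[abs_def])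
qed

lemma bump_nonneg: "bump x \<ge> 0"
  by (simp add: bump_def ell_def)

lemma bump_eq_0: "x \<le> 0 \<or> x \<ge> 1 \<Longrightarrow> bump x = 0"
  by (auto simp: bump_def ell_def)

lemma bump_symmetric: "bump (1 - x) = bump x"
  by (simp add: bump_def algebra_simps)

lemma continuous_on_bump: "continuous_on S bump"
  unfolding bump_def
  by (intro continuous_at_imp_continuous_on ballI continuous_intros isCont_o2[OF _ isCont_ell])

lemma alpha0_eq: "alpha0 = integral {0..1} bump"
  by (simp add: alpha0_def bump_def[abs_def])

lemma lam_eq: "lam t = (1 / alpha0) * integral {0..t} bump"
  by (simp add: lam_def bump_def[abs_def])

text \<open>A continuous nonnegative function with integral 0 would vanish on the whole interval,
  but \<open>bump\<close> is positive at 1/2.\<close>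

lemma alpha0_pos: "alpha0 > 0"
proof -
  have "integral {0..1} bump \<noteq> 0"
  proof
    assume "integral {0..1} bump = 0"
    then have "\<forall>x\<in>{0..1}. bump x = 0"
      using integral_eq_0_iff[OF continuous_on_bump, of 0 1] bump_nonneg by simp
    then have "bump (1/2) = 0" by simp
    then show False by (simp add: bump_def ell_def)
  qed
  moreover have "integral {0..1} bump \<ge> 0"
    by (intro integral_nonneg integrable_continuous_real continuous_on_bump) (simp add: bump_nonneg)
  ultimately show ?thesis
    by (simp add: alpha0_eq)
qed

lemma lam_has_real_derivative: "(lam has_real_derivative bump t / alpha0) (at t)"
proof -
  have "((\<lambda>t. integral {0..t} bump) has_real_derivative bump t) (at t)"
    using continuous_on_bump bump_eq_0 by (intro integral_from_0_has_real_derivative) auto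
  from DERIV_cmult[OF this, of "1 / alpha0"] show ?thesis
    by (simp add: lam_eq[abs_def])
qed

lemma preserves_Ck_lam: "preserves_Ck UNIV lam"
  by (rule preserves_Ck_antiderivative[OF lam_has_real_derivative
        preserves_Ck_cmult[OF preserves_Ck_bump, of "1 / alpha0", simplified]])

lemma lam_mono: "s \<le> t \<Longrightarrow> lam s \<le> lam t"
  by (rule DERIV_nonneg_imp_nondecreasing)
     (auto intro!: exI lam_has_real_derivative divide_nonneg_pos bump_nonneg alpha0_pos)

lemma lam_eq_0: "t \<le> 0 \<Longrightarrow> lam t = 0"
  by (cases "t = 0") (simp_all add: lam_eq)

lemma lam_eq_1:
  assumes "t \<ge> 1"
  shows "lam t = 1"
proof -
  have "lam 1 = lam t"
  proof (rule DERIV_zero_imp_eq[OF assms])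
    fix x :: real assume "1 \<le> x"
    then show "(lam has_real_derivative 0) (at x)"
      using lam_has_real_derivative[of x] by (simp add: bump_eq_0)
  qed
  moreover have "lam 1 = 1"
    using alpha0_pos by (simp add: lam_eq alpha0_eq)
  ultimately show ?thesis by simp
qed

lemma lam_nonneg: "lam t \<ge> 0"
  using lam_mono[of 0 t] lam_eq_0[of t] lam_eq_0[of 0] by (cases "t \<le> 0") auto

lemma lam_le_1: "lam t \<le> 1"
  using lam_mono[of t "max t 1"] lam_eq_1[of "max t 1"] by simp

text \<open>The symmetry of \<open>bump\<close> about 1/2 makes the derivative of the sum vanish.
  This fixes the value of \<open>phi\<close> at 1/2.\<close>

lemma lam_symmetric: "lam t + lam (1 - t) = 1"
proof -
  have "((\<lambda>t. lam t + lam (1 - t)) has_real_derivative 0) (at x)" for x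
    by (rule derivative_eq_intros lam_has_real_derivative DERIV_chain2[OF lam_has_real_derivative] refl)+
       (simp add: bump_symmetric)
  then have "lam t + lam (1 - t) = lam 0 + lam (1 - 0)"
    by (intro DERIV_isconst_all allI)
  then show ?thesis by (simp add: lam_eq_0 lam_eq_1)
qed

section \<open>Comparison of \<open>phi\<close> with the identity\<close>

lemma phi_has_real_derivative: "(phi has_real_derivative lam (1/2 + t)) (at t)"
proof -
  have "((\<lambda>t. integral {0..t} lam) has_real_derivative lam (1/2 + t)) (at (1/2 + t))"
    using lam_has_real_derivative lam_eq_0
    by (intro integral_from_0_has_real_derivative continuous_at_imp_continuous_on)
       (auto intro: DERIV_isCont)
  then have "((\<lambda>t. integral {0..1/2 + t} lam) has_real_derivative lam (1/2 + t) * (0 + 1)) (at t)"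
    by (rule DERIV_chain2) (intro derivative_intros)
  then show ?thesis by (simp add: phi_def[abs_def])
qed

lemma phi_mono: "s \<le> t \<Longrightarrow> phi s \<le> phi t"
  by (rule DERIV_nonneg_imp_nondecreasing) (auto intro!: exI phi_has_real_derivative lam_nonneg)

lemma preserves_Ck_phi: "preserves_Ck UNIV phi"
proof -
  have "preserves_Ck UNIV (\<lambda>t. lam (1/2 + t))"
    using preserves_Ck_affine[OF preserves_Ck_lam, of 1 "1/2"] by (simp add: add.commute)
  with phi_has_real_derivative show ?thesis by (rule preserves_Ck_antiderivative)
qed

text \<open>From 1/2 on \<open>phi\<close> has slope 1, so one value suffices. By
  \<open>lam_symmetric\<close>, phi(s) - phi(-s) - s is constantly 0; as \<open>phi\<close> vanishes
  at -1/2, its value at 1/2 is 1/2.\<close>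

lemma phi_eq_self:
  assumes "t \<ge> 1/2"
  shows "phi t = t"
proof -
  have "((\<lambda>s. phi s - phi (- s) - s) has_real_derivative 0) (at x)" for x
    by (rule derivative_eq_intros phi_has_real_derivative DERIV_chain2[OF phi_has_real_derivative] refl)+
       (use lam_symmetric[of "1/2 + x"] in simp)
  then have "phi (1/2) - phi (- (1/2)) - 1/2 = phi 0 - phi (- 0) - 0"
    by (intro DERIV_isconst_all allI)
  moreover have "phi (- (1/2)) = 0"
    by (simp add: phi_def)
  moreover have "phi (1/2) - 1/2 = phi t - t"
  proof (rule DERIV_zero_imp_eq[OF assms])
    fix x :: real assume "1/2 \<le> x"
    then show "((\<lambda>s. phi s - s) has_real_derivative 0) (at x)"
      using DERIV_diff[OF phi_has_real_derivative DERIV_ident, of x] by (simp add: lam_eq_1)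
  qed
  ultimately show ?thesis by simp
qed

text \<open>The slope of \<open>phi\<close> is at most 1, so phi(s) - s decreases weakly to its
  value 0 at 1/2.\<close>

lemma phi_ge_self: "phi t \<ge> t"
proof (cases "t \<ge> 1/2")
  case False
  have "phi (1/2) - 1/2 \<le> phi t - t"
  proof (rule DERIV_nonpos_imp_nonincreasing[where f = "\<lambda>s. phi s - s"])
    fix x
    have "((\<lambda>s. phi s - s) has_real_derivative lam (1/2 + x) - 1) (at x)"
      by (intro derivative_intros phi_has_real_derivative)
    then show "\<exists>y. ((\<lambda>s. phi s - s) has_real_derivative y) (at x) \<and> y \<le> 0"
      using lam_le_1[of "1/2 + x"] by auto
  qed (use False in auto)
  then show ?thesis by (simp add: phi_eq_self)
qed (simp add: phi_eq_self)

section \<open>Shear maps and the diffeomorphism\<close>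

text \<open>The C of the overview. With s = a + b, the condition a \<ge> 1 - phi(2 - s) of
  \<open>DD\<close> reads b \<le> 1 + excess(s).\<close>

definition excess :: "real \<Rightarrow> real" where
  "excess s = phi (2 - s) - (2 - s)"

text \<open>The \<rho> of the overview: \<open>lam\<close> rescaled so that its rise takes place
  between 1/2 and 1.\<close>

definition cutoff :: "real \<Rightarrow> real" where
  "cutoff b = lam (2 * b - 1)"

lemma excess_nonneg: "excess s \<ge> 0"
  using phi_ge_self[of "2 - s"] by (simp add: excess_def)

lemma excess_eq_0: "s \<le> 3/2 \<Longrightarrow> excess s = 0"
  by (simp add: excess_def phi_eq_self)

lemma Ck_excess:
  assumes "open_euclid k U" "Ck k r U g"
  shows "Ck k r U (\<lambda>x. excess (g x))"
proof -
  have g2: "Ck k r U (\<lambda>x. 2 - g x)"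
    by (rule Ck_diff[OF assms(1) Ck_const assms(2)])
  show ?thesis
    unfolding excess_def
    by (rule Ck_diff[OF assms(1) preserves_CkD[OF preserves_Ck_phi assms(1) g2] g2]) simp
qed

lemma preserves_Ck_cutoff: "preserves_Ck UNIV cutoff"
  using preserves_Ck_affine[OF preserves_Ck_lam, of 2 "-1"] by (simp add: cutoff_def[abs_def])

text \<open>The derivative is written as a multiple of an affine substitution, the shape to which
  \<open>preserves_Ck_cmult\<close> and \<open>preserves_Ck_affine\<close> apply.\<close>

lemma cutoff_has_real_derivative:
  "(cutoff has_real_derivative 2 / alpha0 * bump (2 * b + (-1))) (at b)"
proof -
  have "((\<lambda>b. lam (2 * b - 1)) has_real_derivative bump (2 * b - 1) / alpha0 * 2) (at b)"
    by (rule DERIV_chain2[OF lam_has_real_derivative]) (auto intro!: derivative_eq_intros)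
  then show ?thesis
    by (simp add: cutoff_def[abs_def] mult.commute)
qed

lemma cutoff_mono: "a \<le> b \<Longrightarrow> cutoff a \<le> cutoff b"
  by (simp add: cutoff_def lam_mono)

lemma cutoff_nonneg: "cutoff b \<ge> 0"
  by (simp add: cutoff_def lam_nonneg)

lemma cutoff_le_1: "cutoff b \<le> 1"
  by (simp add: cutoff_def lam_le_1)

lemma cutoff_eq_0: "b \<le> 1/2 \<Longrightarrow> cutoff b = 0"
  by (simp add: cutoff_def lam_eq_0)

lemma cutoff_eq_1: "b \<ge> 1 \<Longrightarrow> cutoff b = 1"
  by (simp add: cutoff_def lam_eq_1)

text \<open>The inverse of the strictly increasing map b + c * cutoff(b) for c \<ge> 0, made total
  by choice.\<close>

definition unstretch :: "real \<Rightarrow> real \<Rightarrow> real" where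
  "unstretch c y = (SOME b. b + c * cutoff b = y)"

text \<open>Since \<open>cutoff\<close> lies between 0 and 1, the intermediate value theorem finds a
  solution between y - c and y.\<close>

lemma unstretch_eq:
  assumes "c \<ge> 0"
  shows "unstretch c y + c * cutoff (unstretch c y) = y"
proof -
  have "\<exists>b\<ge>y - c. b \<le> y \<and> b + c * cutoff b = y"
  proof (rule IVT')
    show "y - c + c * cutoff (y - c) \<le> y"
      using mult_left_mono[OF cutoff_le_1 assms] by simp
    show "y \<le> y + c * cutoff y"
      using assms cutoff_nonneg by simp
    show "continuous_on {y - c..y} (\<lambda>b. b + c * cutoff b)"
      by (intro continuous_intros continuous_at_imp_continuous_on ballI
          DERIV_isCont[OF cutoff_has_real_derivative])
  qed (use assms in simp)
  then have "\<exists>b. b + c * cutoff b = y" by blast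
  then show ?thesis
    unfolding unstretch_def by (rule someI_ex)
qed

lemma unstretch_unique:
  assumes "c \<ge> 0" "b + c * cutoff b = y"
  shows "unstretch c y = b"
proof -
  let ?u = "unstretch c y"
  have eq: "?u + c * cutoff ?u = b + c * cutoff b"
    using unstretch_eq[OF assms(1), of y] assms(2) by simp
  have "x \<le> z \<Longrightarrow> c * cutoff x \<le> c * cutoff z" for x z
    using assms(1) by (simp add: mult_left_mono cutoff_mono)
  \<comment> \<open>Whichever of the two solutions is larger, its \<open>cutoff\<close> term is at
    least as large, so equal sums force equal solutions.\<close>
  from this[of ?u b] this[of b ?u] eq show ?thesis by linarith
qed

lemma Ck_unstretch:
  assumes "open_euclid k U" "Ck k r U c" "Ck k r U y" "\<And>x. x \<in> U \<Longrightarrow> c x \<ge> 0"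
  shows "Ck k r U (\<lambda>x. unstretch (c x) (y x))"
proof -
  have pos: "2 / alpha0 * bump (2 * b + (-1)) \<ge> 0" for b
    using alpha0_pos bump_nonneg by simp
  show ?thesis
    by (rule Ck_implicit[OF assms(1) unstretch_eq[OF assms(4)] assms(4) cutoff_has_real_derivative
          pos preserves_Ck_cmult[OF preserves_Ck_affine[OF preserves_Ck_bump]] assms(2,3)])
qed

text \<open>Where one of the two norms vanishes, the quotient is the junk value 0; this is harmless,
  because the corresponding coordinates of z vanish there as well.\<close>

definition slide :: "nat \<Rightarrow> nat \<Rightarrow> (real \<Rightarrow> real \<Rightarrow> real) \<Rightarrow> (nat \<Rightarrow> real) \<Rightarrow> nat \<Rightarrow> real" where
  "slide n m T z i =
     (if i < n then z i * (1 - T (normU n z) (normV n m z) / normU n z)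
      else if i < n + m then z i * (1 + T (normU n z) (normV n m z) / normV n m z) else 0)"

section \<open>Transfer of length between the two blocks of coordinates\<close>

lemma normU_nonneg: "normU n z \<ge> 0"
  by (simp add: normU_def sum_nonneg)

lemma normV_nonneg: "normV n m z \<ge> 0"
  by (simp add: normV_def sum_nonneg)

lemma normU_scale:
  assumes "\<And>i. i < n \<Longrightarrow> w i = z i * c"
  shows "normU n w = normU n z * \<bar>c\<bar>"
proof -
  have "(\<Sum>i<n. (w i)\<^sup>2) = (\<Sum>i<n. (z i)\<^sup>2) * c\<^sup>2"
    by (simp add: assms power_mult_distrib sum_distrib_right)
  then show ?thesis
    by (simp add: normU_def real_sqrt_mult)
qed

lemma normV_scale:
  assumes "\<And>i. n \<le> i \<Longrightarrow> i < n + m \<Longrightarrow> w i = z i * c"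
  shows "normV n m w = normV n m z * \<bar>c\<bar>"
proof -
  have "(\<Sum>i\<in>{n..<n+m}. (w i)\<^sup>2) = (\<Sum>i\<in>{n..<n+m}. (z i)\<^sup>2) * c\<^sup>2"
    by (simp add: assms power_mult_distrib sum_distrib_right)
  then show ?thesis
    by (simp add: normV_def real_sqrt_mult)
qed

lemma slide_in_euclid: "slide n m T z \<in> euclid (n + m)"
  by (simp add: slide_def euclid_def)

text \<open>The bound keeps the scaling factor nonnegative, so no absolute value remains; a zero
  block stays zero, hence nothing may be transferred from it.\<close>

lemma normU_slide:
  assumes "T (normU n z) (normV n m z) \<le> normU n z"
    and "normU n z = 0 \<Longrightarrow> T (normU n z) (normV n m z) = 0"
  shows "normU n (slide n m T z) = normU n z - T (normU n z) (normV n m z)"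
proof -
  let ?a = "normU n z" and ?t = "T (normU n z) (normV n m z)"
  have "normU n (slide n m T z) = ?a * \<bar>1 - ?t / ?a\<bar>"
    by (rule normU_scale) (simp add: slide_def)
  also have "\<dots> = ?a - ?t"
  proof (cases "?a = 0")
    case False
    then have "1 - ?t / ?a \<ge> 0"
      using assms(1) normU_nonneg[of n z] by (simp add: divide_le_eq_1)
    with False show ?thesis by (simp add: right_diff_distrib)
  qed (use assms(2) in simp)
  finally show ?thesis .
qed

lemma normV_slide:
  assumes "- T (normU n z) (normV n m z) \<le> normV n m z"
    and "normV n m z = 0 \<Longrightarrow> T (normU n z) (normV n m z) = 0"
  shows "normV n m (slide n m T z) = normV n m z + T (normU n z) (normV n m z)"
proof -
  let ?b = "normV n m z" and ?t = "T (normU n z) (normV n m z)"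
  have "normV n m (slide n m T z) = ?b * \<bar>1 + ?t / ?b\<bar>"
    by (rule normV_scale) (simp add: slide_def)
  also have "\<dots> = ?b + ?t"
  proof (cases "?b = 0")
    case False
    then have "?b > 0" using normV_nonneg[of n m z] by simp
    then have "1 + ?t / ?b \<ge> 0"
      using assms(1) by (simp add: field_simps)
    with False show ?thesis by (simp add: distrib_left)
  qed (use assms(2) in simp)
  finally show ?thesis .
qed

text \<open>The inequalities keep both new norms nonnegative. The last clause makes the transfer
  reversible: a zero block cannot be lengthened, and the direction of a block scaled to zero cannot
  be recovered.\<close>

definition slidable :: "(real \<Rightarrow> real \<Rightarrow> real) \<Rightarrow> real \<Rightarrow> real \<Rightarrow> bool" where
  "slidable T a b \<longleftrightarrow> T a b \<le> a \<and> - T a b \<le> b \<and>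
     (a = 0 \<or> b = 0 \<or> a - T a b = 0 \<or> b + T a b = 0 \<longrightarrow> T a b = 0)"

lemma norms_slide:
  assumes "slidable T (normU n z) (normV n m z)"
  shows "normU n (slide n m T z) = normU n z - T (normU n z) (normV n m z)"
    and "normV n m (slide n m T z) = normV n m z + T (normU n z) (normV n m z)"
  using assms normU_slide[of T n z m] normV_slide[of T n z m] by (auto simp: slidable_def)

text \<open>On each block the two scaling factors are reciprocal, for instance (a - T)/a and a/(a -
  T). If the transfer is 0, both are 1 even where a norm vanishes; otherwise \<open>slidable\<close>
  makes all denominators nonzero.\<close>

lemma slide_slide:
  assumes z: "z \<in> euclid (n + m)" and ab: "a = normU n z" "b = normV n m z"
    and T: "slidable T a b" and T': "T' (a - T a b) (b + T a b) = - T a b"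
  shows "slide n m T' (slide n m T z) = z"
proof
  fix i
  have N: "normU n (slide n m T z) = a - T a b" "normV n m (slide n m T z) = b + T a b"
    using norms_slide T unfolding ab by blast+
  have U: "(1 - T a b / a) * (1 + T a b / (a - T a b)) = 1"
    using T by (cases "T a b = 0") (auto simp: slidable_def field_simps)
  have V: "(1 + T a b / b) * (1 - T a b / (b + T a b)) = 1"
  proof (cases "T a b = 0")
    case False
    with T have "b \<noteq> 0" "b + T a b \<noteq> 0"
      by (auto simp: slidable_def)
    then have "1 + T a b / b = (b + T a b) / b" "1 - T a b / (b + T a b) = b / (b + T a b)"
      by (simp_all add: add_divide_distrib diff_divide_eq_iff)
    with \<open>b \<noteq> 0\<close> \<open>b + T a b \<noteq> 0\<close> show ?thesis by simp
  qed simp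
  have eq: "slide n m T' (slide n m T z) i =
      (if i < n then slide n m T z i * (1 + T a b / (a - T a b))
       else if i < n + m then slide n m T z i * (1 - T a b / (b + T a b)) else 0)"
    unfolding slide_def[of n m T'] N by (simp add: T')
  consider "i < n" | "n \<le> i" "i < n + m" | "n + m \<le> i" by linarith
  then show "slide n m T' (slide n m T z) i = z i"
  proof cases
    case 1
    then have "slide n m T z i = z i * (1 - T a b / a)"
      by (simp add: slide_def ab)
    with 1 U show ?thesis by (simp add: eq mult.assoc)
  next
    case 2
    then have "slide n m T z i = z i * (1 + T a b / b)"
      by (simp add: slide_def ab)
    with 2 V show ?thesis by (simp add: eq mult.assoc)
  next
    case 3
    with z show ?thesis by (simp add: eq euclid_def)
  qed
qed

text \<open>Locally either \<open>T0\<close> makes the map the identity, or both norms are positive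
  and the formula for \<open>slide\<close> is built from smooth operations. The hypothesis
  \<open>near\<close> ensures that these regions cover \<open>U\<close>.\<close>

lemma smooth_map_slide:
  assumes U: "open_euclid k U" and p: "smooth_map k U (n + m) p"
    and near: "\<And>x. x \<in> U \<Longrightarrow> normU n (p x) = 0 \<Longrightarrow> normV n m (p x) < 3/2"
    and T0: "\<And>a b. a \<ge> 0 \<Longrightarrow> b \<ge> 0 \<Longrightarrow> a + b < 3/2 \<or> b < 1/2 \<Longrightarrow> T a b = 0"
    and T_Ck: "\<And>r V f g. open_euclid k V \<Longrightarrow> Ck k r V f \<Longrightarrow> Ck k r V g \<Longrightarrow>
      Ck k r V (\<lambda>x. T (f x) (g x))"
  shows "smooth_map k U (n + m) (slide n m T \<circ> p)"
  unfolding smooth_map_def smooth_real_def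
proof (intro allI impI)
  fix j r assume j: "j < n + m"
  have p_Ck: "Ck k r U (\<lambda>x. p x i)" if "i < n + m" for i r
    using p that by (simp add: smooth_map_def smooth_real_def)
  define A where "A x = normU n (p x)" for x
  define B where "B x = normV n m (p x)" for x
  have sqA: "Ck k r U (\<lambda>x. \<Sum>i<n. (p x i)\<^sup>2)" and sqB: "Ck k r U (\<lambda>x. \<Sum>i\<in>{n..<n+m}. (p x i)\<^sup>2)" for r
    unfolding power2_eq_square by (intro Ck_sum[OF U] Ck_mult[OF U] p_Ck; simp)+
  \<comment> \<open>On all of \<open>U\<close> the norms are shown only to be continuous, since
    \<open>sqrt\<close> is not differentiable at 0; that suffices to make the sets below
    open.\<close>
  have A: "cont_euclid k U A" and B: "cont_euclid k U B"
    unfolding A_def[abs_def] B_def[abs_def] normU_def normV_def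
    by (rule cont_euclid_compose[where F = sqrt], rule Ck_imp_cont, rule sqA sqB, rule isCont_real_sqrt)+
  have AB: "cont_euclid k U (\<lambda>x. A x + B x)"
    using Ck_add[OF U, of 0 A B] A B by simp
  have id: "slide n m T (p x) j = p x j" if "A x + B x < 3/2 \<or> B x < 1/2" for x
    using T0[OF normU_nonneg normV_nonneg, of n "p x" n m "p x"] that j
    by (auto simp: slide_def A_def B_def)
  have id_Ck: "Ck k r V (\<lambda>x. (slide n m T \<circ> p) x j)"
    if "open_euclid k V" "V \<subseteq> U" "\<And>x. x \<in> V \<Longrightarrow> A x + B x < 3/2 \<or> B x < 1/2" for V
    by (rule Ck_cong_imp[OF that(1) Ck_subset[OF p_Ck[OF j] that(2)]]) (simp add: id[OF that(3)])
  show "Ck k r U (\<lambda>x. (slide n m T \<circ> p) x j)"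
  proof (rule Ck_local)
    fix x assume x: "x \<in> U"
    \<comment> \<open>If \<open>A x\<close> is 0, \<open>near\<close> gives the first case; if
      \<open>B x\<close> is 0, the second holds.\<close>
    consider "A x + B x < 3/2" | "B x < 1/2" | "A x > 0" "B x > 0"
      using near[OF x] normU_nonneg[of n "p x"] normV_nonneg[of n m "p x"]
      unfolding A_def B_def by linarith
    then show "\<exists>V. open_euclid k V \<and> x \<in> V \<and> V \<subseteq> U \<and> Ck k r V (\<lambda>x. (slide n m T \<circ> p) x j)"
    proof cases
      case 1
      let ?V = "{x \<in> U. A x + B x \<in> {..<3/2}}"
      have V: "open_euclid k ?V" by (rule open_euclid_preimage[OF U AB open_lessThan])
      have "Ck k r ?V (\<lambda>x. (slide n m T \<circ> p) x j)"
        by (rule id_Ck[OF V]) auto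
      with V 1 x show ?thesis by (intro exI[of _ ?V]) simp
    next
      case 2
      let ?V = "{x \<in> U. B x \<in> {..<1/2}}"
      have V: "open_euclid k ?V" by (rule open_euclid_preimage[OF U B open_lessThan])
      have "Ck k r ?V (\<lambda>x. (slide n m T \<circ> p) x j)"
        by (rule id_Ck[OF V]) auto
      with V 2 x show ?thesis by (intro exI[of _ ?V]) simp
    next
      case 3
      let ?W = "{x \<in> U. A x \<in> {0<..}}"
      let ?V = "{x \<in> ?W. B x \<in> {0<..}}"
      have W: "open_euclid k ?W" by (rule open_euclid_preimage[OF U A open_greaterThan])
      have V: "open_euclid k ?V"
        by (rule open_euclid_preimage[OF W cont_euclid_subset[OF B] open_greaterThan]) blast
      have VU: "?V \<subseteq> U" by blast
      have pos: "A x > 0" "B x > 0" if "x \<in> ?V" for x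
        using that by simp_all
      have "Ck k r ?V (\<lambda>x. sqrt (\<Sum>i<n. (p x i)\<^sup>2))"
        by (rule Ck_sqrt[OF V Ck_subset[OF sqA VU]]) (drule pos(1), simp add: A_def normU_def)
      then have A_Ck: "Ck k r ?V A"
        by (rule Ck_cong_imp[OF V]) (simp add: A_def normU_def)
      have "Ck k r ?V (\<lambda>x. sqrt (\<Sum>i\<in>{n..<n+m}. (p x i)\<^sup>2))"
        by (rule Ck_sqrt[OF V Ck_subset[OF sqB VU]]) (drule pos(2), simp add: B_def normV_def)
      then have B_Ck: "Ck k r ?V B"
        by (rule Ck_cong_imp[OF V]) (simp add: B_def normV_def)
      have p_V: "Ck k r ?V (\<lambda>x. p x j)"
        by (rule Ck_subset[OF p_Ck[OF j] VU])
      have T: "Ck k r ?V (\<lambda>x. T (A x) (B x))"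
        by (rule T_Ck[OF V A_Ck B_Ck])
      have "Ck k r ?V (\<lambda>x. (slide n m T \<circ> p) x j)"
      proof (cases "j < n")
        case True
        have "Ck k r ?V (\<lambda>x. p x j * (1 - T (A x) (B x) / A x))"
          by (rule Ck_mult[OF V p_V Ck_diff[OF V Ck_const Ck_divide[OF V T A_Ck pos(1)]]])
        then show ?thesis
          by (rule Ck_cong_imp[OF V]) (simp add: slide_def A_def B_def True)
      next
        case False
        have "Ck k r ?V (\<lambda>x. p x j * (1 + T (A x) (B x) / B x))"
          by (rule Ck_mult[OF V p_V Ck_add[OF V Ck_const Ck_divide[OF V T B_Ck pos(2)]]])
        then show ?thesis
          by (rule Ck_cong_imp[OF V]) (simp add: slide_def A_def B_def False j)
      qed
      with V VU 3 x show ?thesis by (intro exI[of _ ?V]) simp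
    qed
  qed (use U in \<open>simp add: open_euclid_def\<close>)
qed

text \<open>Permits exchanging \<open>inv_into\<close> for the explicit inverse along a
  plot.\<close>

lemma plot_cong:
  assumes "plot N X k U p" "\<And>x. x \<in> U \<Longrightarrow> p x = q x"
  shows "plot N X k U q"
proof -
  have U: "open_euclid k U" using assms(1) by (simp add: plot_def)
  have "Ck k r U (\<lambda>x. q x j)" if "j < N" for r j
    by (rule Ck_cong_imp[OF U, of r "\<lambda>x. p x j"])
       (use assms that in \<open>simp_all add: plot_def smooth_map_def smooth_real_def\<close>)
  moreover have "q ` U \<subseteq> X"
    using assms by (auto simp: plot_def)
  ultimately show ?thesis
    using U by (simp add: plot_def smooth_map_def smooth_real_def)
qed

section \<open>The displacements of the map and of its inverse\<close>

definition push :: "real \<Rightarrow> real \<Rightarrow> real" where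
  "push a b = excess (a + b) * cutoff b"

text \<open>\<open>unstretch\<close> returns the new norm of v; subtracting the old one gives the
  displacement, which is nonpositive.\<close>

definition pull :: "real \<Rightarrow> real \<Rightarrow> real" where
  "pull a b = unstretch (excess (a + b)) b - b"

lemma push_nonneg: "push a b \<ge> 0"
  by (simp add: push_def excess_nonneg cutoff_nonneg)

lemma push_eq_0: "a + b < 3/2 \<or> b < 1/2 \<Longrightarrow> push a b = 0"
  by (auto simp: push_def excess_eq_0 cutoff_eq_0)

lemma Ck_push:
  assumes "open_euclid k V" "Ck k r V f" "Ck k r V g"
  shows "Ck k r V (\<lambda>x. push (f x) (g x))"
  unfolding push_def
  by (rule Ck_mult[OF assms(1) Ck_excess[OF assms(1) Ck_add[OF assms]]
        preserves_CkD[OF preserves_Ck_cutoff assms(1,3)]]) simp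

text \<open>The transfer preserves a + b, so both directions use the same \<open>excess\<close> and
  \<open>unstretch_unique\<close> applies.\<close>

lemma pull_push: "pull (a - push a b) (b + push a b) = - push a b"
  using unstretch_unique[OF excess_nonneg, of b "a + b" "b + push a b"]
  by (simp add: pull_def push_def)

lemma push_bounds:
  assumes "a \<ge> 0" "b \<ge> 0" "b \<le> 1"
  shows "slidable push a b" and "1 - phi (2 - (a + b)) \<le> a - push a b"
proof -
  have "push a b \<le> excess (a + b)"
    using mult_left_mono[OF cutoff_le_1 excess_nonneg] by (simp add: push_def)
  then show le: "1 - phi (2 - (a + b)) \<le> a - push a b"
    using assms(3) by (simp add: excess_def)
  \<comment> \<open>A nonzero transfer forces a + b \<ge> 3/2, where
    \<open>phi (2 - (a + b))\<close> is at most 1/2; by \<open>le\<close> the remaining norm is then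
    at least 1/2.\<close>
  have pos: "a - push a b > 0" if "push a b \<noteq> 0"
  proof -
    have "a + b \<ge> 3/2" using that push_eq_0 by force
    then have "phi (2 - (a + b)) \<le> 1/2"
      using phi_mono[of "2 - (a + b)" "1/2"] by (simp add: phi_eq_self)
    with le show ?thesis by simp
  qed
  have "b > 0" if "push a b \<noteq> 0"
    using that push_eq_0[of a b] by force
  with pos show "slidable push a b"
    using push_nonneg[of a b] assms(1,2) unfolding slidable_def
    by (cases "push a b = 0") simp_all
qed

text \<open>The equation solved by \<open>unstretch\<close>, as a fixed-point equation. As
  \<open>pull a b\<close> recurs on the right, it is unfolded just once at a time, by
  \<open>subst\<close>.\<close>

lemma pull_eq: "pull a b = - (excess (a + b) * cutoff (b + pull a b))"
  using unstretch_eq[OF excess_nonneg, of "a + b" b] by (simp add: pull_def)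

lemma pull_nonpos: "pull a b \<le> 0"
  by (subst pull_eq) (simp add: excess_nonneg cutoff_nonneg)

lemma pull_eq_0:
  assumes "a + b < 3/2 \<or> b < 1/2"
  shows "pull a b = 0"
  using assms
proof
  assume "a + b < 3/2"
  then show ?thesis by (subst pull_eq) (simp add: excess_eq_0)
next
  assume "b < 1/2"
  then have "cutoff (b + pull a b) = 0"
    using pull_nonpos[of a b] by (intro cutoff_eq_0) simp
  then show ?thesis by (subst pull_eq) simp
qed

lemma Ck_pull:
  assumes "open_euclid k V" "Ck k r V f" "Ck k r V g"
  shows "Ck k r V (\<lambda>x. pull (f x) (g x))"
  unfolding pull_def
  by (rule Ck_diff[OF assms(1) Ck_unstretch[OF assms(1) Ck_excess[OF assms(1) Ck_add[OF assms]]
        assms(3) excess_nonneg] assms(3)])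

lemma push_pull: "push (a - pull a b) (b + pull a b) = - pull a b"
  using pull_eq[of a b] by (simp add: push_def)

text \<open>By monotonicity, compare with \<open>max t (1/2)\<close>, where \<open>phi\<close> is
  the identity. The consequence is that target points with u = 0 satisfy b \<le> 1.\<close>

lemma phi_ge_1_imp:
  assumes "phi t \<ge> 1"
  shows "t \<ge> 1"
proof (rule ccontr)
  assume "\<not> t \<ge> 1"
  then have "phi (max t (1/2)) < 1"
    by (subst phi_eq_self) auto
  moreover have "phi t \<le> phi (max t (1/2))"
    by (intro phi_mono) simp
  ultimately show False using assms by linarith
qed

lemma pull_bounds:
  assumes "a \<ge> 0" "b \<ge> 0" "1 - phi (2 - (a + b)) \<le> a"
  shows "slidable pull a b" and "b + pull a b \<le> 1"
proof -
  show le: "b + pull a b \<le> 1"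
  proof (rule ccontr)
    assume "\<not> b + pull a b \<le> 1"
    \<comment> \<open>Beyond 1 the cutoff is 1, so the new norm is \<open>b\<close> minus the full
      \<open>excess\<close>, which the target inequality bounds by 1.\<close>
    moreover from this have "b + pull a b + excess (a + b) = b"
      using pull_eq[of a b] by (simp add: cutoff_eq_1)
    ultimately show False
      using assms(3) by (simp add: excess_def)
  qed
  have "b + pull a b > 0" if "pull a b \<noteq> 0"
  proof (rule ccontr)
    assume "\<not> b + pull a b > 0"
    then have "cutoff (b + pull a b) = 0" by (intro cutoff_eq_0) simp
    then have "pull a b = 0" by (subst pull_eq) simp
    with that show False ..
  qed
  moreover have "a \<noteq> 0" if "pull a b \<noteq> 0"
  proof
    assume "a = 0"
    then have "2 - (a + b) \<ge> 1" using assms(3) phi_ge_1_imp[of "2 - (a + b)"] by simp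
    then show False using that pull_eq_0[of a b] by simp
  qed
  \<comment> \<open>As \<open>pull\<close> is nonpositive, b \<ge> b + pull > 0 and a - pull \<ge> a
    > 0 whenever the transfer is nonzero.\<close>
  ultimately show "slidable pull a b"
    using pull_nonpos[of a b] assms(1,2) unfolding slidable_def
    by (cases "pull a b = 0") auto
qed

section \<open>Assembly of the diffeomorphism\<close>

theorem theorem3p5:
  fixes n m :: nat
  shows "\<exists>\<Psi>. diffeomorphism (n + m) (RnDm n m) (n + m) (DD n m) \<Psi>"
proof
  let ?X = "RnDm n m" and ?Y = "DD n m"
  let ?\<Psi> = "slide n m push" and ?\<Phi> = "slide n m pull"
  have X: "slidable push (normU n z) (normV n m z)"
    "1 - phi (2 - (normU n z + normV n m z)) \<le> normU n z - push (normU n z) (normV n m z)"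
    if "z \<in> ?X" for z
    using push_bounds[OF normU_nonneg normV_nonneg, of n m z n z] that by (simp_all add: RnDm_def)
  have Y: "slidable pull (normU n z) (normV n m z)"
    "normV n m z + pull (normU n z) (normV n m z) \<le> 1" if "z \<in> ?Y" for z
    using pull_bounds[OF normU_nonneg normV_nonneg, of n z n m z] that
    by (simp_all add: DD_def diff_diff_eq)
  have \<Psi>: "?\<Psi> z \<in> ?Y" if "z \<in> ?X" for z
    using X[OF that] norms_slide[OF X(1)[OF that]] by (simp add: DD_def slide_in_euclid diff_diff_eq)
  have \<Phi>: "?\<Phi> z \<in> ?X" if "z \<in> ?Y" for z
    using Y[OF that] norms_slide[OF Y(1)[OF that]] by (simp add: RnDm_def slide_in_euclid)
  have \<Phi>\<Psi>: "?\<Phi> (?\<Psi> z) = z" if "z \<in> ?X" for z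
    using slide_slide[where T = push and T' = pull, OF _ refl refl X(1)[OF that] pull_push] that
    by (simp add: RnDm_def)
  have \<Psi>\<Phi>: "?\<Psi> (?\<Phi> z) = z" if "z \<in> ?Y" for z
    using slide_slide[where T = pull and T' = push, OF _ refl refl Y(1)[OF that] push_pull] that
    by (simp add: DD_def)
  have bij: "bij_betw ?\<Psi> ?X ?Y"
    by (rule bij_betw_byWitness[where f' = ?\<Phi>]) (use \<Psi> \<Phi> \<Phi>\<Psi> \<Psi>\<Phi> in auto)
  have smooth_\<Psi>: "plot (n + m) ?Y k U (?\<Psi> \<circ> p)" if p: "plot (n + m) ?X k U p" for k U p
  proof -
    have "smooth_map k U (n + m) (?\<Psi> \<circ> p)"
    proof (rule smooth_map_slide)
      fix x assume "x \<in> U"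
      with p have "p x \<in> ?X" by (auto simp: plot_def)
      then show "normV n m (p x) < 3/2" by (simp add: RnDm_def)
    qed (use p in \<open>simp_all add: plot_def push_eq_0 Ck_push\<close>)
    with p \<Psi> show ?thesis by (auto simp: plot_def)
  qed
  have smooth_\<Phi>: "plot (n + m) ?X k U (?\<Phi> \<circ> p)" if p: "plot (n + m) ?Y k U p" for k U p
  proof -
    have "smooth_map k U (n + m) (?\<Phi> \<circ> p)"
    proof (rule smooth_map_slide)
      \<comment> \<open>In the target b may exceed 1 in general, but not where u = 0. For n = 0 that
        is every point.\<close>
      fix x assume "x \<in> U" and u: "normU n (p x) = 0"
      with p have "p x \<in> ?Y" by (auto simp: plot_def)
      with u have "2 - normV n m (p x) \<ge> 1"
        using phi_ge_1_imp[of "2 - normV n m (p x)"] by (simp add: DD_def)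
      then show "normV n m (p x) < 3/2" by simp
    qed (use p in \<open>simp_all add: plot_def pull_eq_0 Ck_pull\<close>)
    with p \<Phi> show ?thesis by (auto simp: plot_def)
  qed
  \<comment> \<open>The definition of a diffeomorphism fixes the inverse as \<open>inv_into\<close>,
    which is identified with the explicit map on the target only; plots take their values
    there.\<close>
  have inv: "inv_into ?X ?\<Psi> z = ?\<Phi> z" if "z \<in> ?Y" for z
    using bij \<Phi>[OF that] \<Psi>\<Phi>[OF that] by (metis bij_betw_inv_into_left)
  have "plot (n + m) ?X k U (inv_into ?X ?\<Psi> \<circ> p)" if p: "plot (n + m) ?Y k U p" for k U p
  proof -
    have "(?\<Phi> \<circ> p) x = (inv_into ?X ?\<Psi> \<circ> p) x" if "x \<in> U" for x
      using p that inv by (auto simp: plot_def)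
    then show ?thesis
      by (rule plot_cong[OF smooth_\<Phi>[OF p]])
  qed
  then show "diffeomorphism (n + m) ?X (n + m) ?Y ?\<Psi>"
    using bij smooth_\<Psi> \<Psi> \<Phi> inv unfolding diffeomorphism_def dsmooth_def by auto
qed

end
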